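(* Let $\mathbb{F}$ be a field and let $\mathbf{L}=\mathbf{V}\rtimes\mathbb{F}e_0$ be an indecomposable almost Abelian Lie algebra over $\mathbb{F}$ that is not isomorphic to the Heisenberg algebra $\mathbf{H}_{\mathbb{F}}$. Then the group of Lie algebra automorphisms of $\mathbf{L}$ is $$\mathrm{Aut}(\mathbf{L})=\left\{\begin{pmatrix}\Delta&\gamma\\ 0&\alpha\end{pmatrix}\;\middle|\;\alpha\in\mathbb{F}^*,\ \gamma\in\mathbf{V},\ \Delta\in\mathrm{Aut}(\mathbf{V}),\ \Delta\,\mathrm{ad}_{e_0}-\alpha\,\mathrm{ad}_{e_0}\Delta=0\right\}.$$
   Context: An almost Abelian Lie algebra over a field $\mathbb{F}$ (of arbitrary, possibly infinite, dimension) is a non-Abelian Lie algebra that contains a codimension 1 Abelian subalgebra; it then has a codimension 1 Abelian ideal. Writing $\mathbf{L}=\mathbf{V}\rtimes\mathbb{F}e_0$ means: $\mathbf{V}\subset\mathbf{L}$ is a codimension 1 Abelian ideal, $e_0\in\mathbf{L}\setminus\mathbf{V}$, and $\mathbf{L}=\mathbf{V}\oplus\mathbb{F}e_0$ as vector spaces. The operator $\mathrm{ad}_{e_0}\in\mathrm{End}_{\mathbb{F}}(\mathbf{V})$ is $v\mapsto[e_0,v]$; it is nonzero. A Lie algebra is decomposable if it is the direct sum of two commuting nonzero Lie subalgebras; otherwise it is indecomposable. $\mathbf{H}_{\mathbb{F}}$ is the 3-dimensional Lie algebra with basis $e_0,e_1,e_2$ and $[e_0,e_2]=e_1$, $[e_0,e_1]=[e_1,e_2]=0$.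 The matrix $\begin{pmatrix}\Delta&\gamma\\ 0&\alpha\end{pmatrix}$ denotes the linear map of $\mathbf{L}$ sending $v+te_0$ to $(\Delta v+t\gamma)+\alpha t e_0$ for $v\in\mathbf{V}$, $t\in\mathbb{F}$. $\mathrm{Aut}(\mathbf{V})$ is the group of invertible linear operators on $\mathbf{V}$, and $\mathbb{F}^*=\mathbb{F}\setminus\{0\}$. *)

theory Defs
  imports Complex_Main "HOL-Library.FuncSet" "HOL-Library.Product_Plus"
begin

locale lie_algebra = vector_space scale
  for scale :: "'f::field \<Rightarrow> 'a::ab_group_add \<Rightarrow> 'a" +
  fixes bracket :: "'a \<Rightarrow> 'a \<Rightarrow> 'a"
  assumes bracket_linear_right: "Vector_Spaces.linear scale scale (\<lambda>y. bracket x y)"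
    and bracket_linear_left: "Vector_Spaces.linear scale scale (\<lambda>x. bracket x y)"
    and bracket_alternating: "bracket x x = 0"
    and jacobi: "bracket x (bracket y z) + bracket y (bracket z x) + bracket z (bracket x y) = 0"
begin

definition abelian_on :: "'a set \<Rightarrow> bool" where
  "abelian_on S \<longleftrightarrow> (\<forall>x\<in>S. \<forall>y\<in>S. bracket x y = 0)"

definition lie_subalgebra :: "'a set \<Rightarrow> bool" where
  "lie_subalgebra S \<longleftrightarrow> subspace S \<and> (\<forall>x\<in>S. \<forall>y\<in>S. bracket x y \<in> S)"

definition lie_ideal :: "'a set \<Rightarrow> bool" where
  "lie_ideal S \<longleftrightarrow> subspace S \<and> (\<forall>x. \<forall>y\<in>S. bracket x y \<in> S)"

definition direct_decomposition :: "'a set \<Rightarrow> 'a set \<Rightarrow> bool" where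
  "direct_decomposition A B \<longleftrightarrow>
     subspace A \<and> subspace B \<and> A \<inter> B = {0} \<and> {a + b | a b. a \<in> A \<and> b \<in> B} = UNIV"

text \<open>The dimension of the quotient by \<open>S\<close> is that of any complement of \<open>S\<close>.
  Note that \<open>dim\<close> is \<open>0\<close> on infinite-dimensional subspaces.\<close>
definition codim_one :: "'a set \<Rightarrow> bool" where
  "codim_one S \<longleftrightarrow> (\<exists>W. direct_decomposition S W \<and> dim W = 1)"

definition indecomposable :: bool where
  "indecomposable \<longleftrightarrow>
     \<not> (\<exists>A B. lie_subalgebra A \<and> lie_subalgebra B \<and> A \<noteq> {0} \<and> B \<noteq> {0} \<and>
          direct_decomposition A B \<and> (\<forall>a\<in>A. \<forall>b\<in>B. bracket a b = 0))"

text \<open>\<open>V \<rtimes> F e\<^sub>0\<close>\<close>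
definition semidirect_presentation :: "'a set \<Rightarrow> 'a \<Rightarrow> bool" where
  "semidirect_presentation V e0 \<longleftrightarrow>
     lie_ideal V \<and> abelian_on V \<and> codim_one V \<and> e0 \<notin> V \<and> direct_decomposition V (span {e0})"

text \<open>The underlying set of the group of invertible linear operators on the subspace \<open>V\<close>;
  operators are made total by \<open>undefined\<close> outside \<open>V\<close>, so that equal operators are equal functions.\<close>
definition linear_automorphisms_on :: "'a set \<Rightarrow> ('a \<Rightarrow> 'a) set" where
  "linear_automorphisms_on V =
     {D \<in> extensional V. bij_betw D V V \<and>
        (\<forall>v\<in>V. \<forall>w\<in>V. D (v + w) = D v + D w) \<and> (\<forall>c. \<forall>v\<in>V. D (scale c v) = scale c (D v))}"

definition e0_coord :: "'a set \<Rightarrow> 'a \<Rightarrow> 'a \<Rightarrow> 'f" where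
  "e0_coord V e0 x = (THE t. x - scale t e0 \<in> V)"

text \<open>The operator with block matrix \<open>(D, \<gamma>; 0, \<alpha>)\<close>; see \<open>block_map_eq\<close> below.\<close>
definition block_map :: "'a set \<Rightarrow> 'a \<Rightarrow> ('a \<Rightarrow> 'a) \<Rightarrow> 'a \<Rightarrow> 'f \<Rightarrow> 'a \<Rightarrow> 'a" where
  "block_map V e0 D \<gamma> \<alpha> x =
     (let t = e0_coord V e0 x in D (x - scale t e0) + scale t \<gamma> + scale (\<alpha> * t) e0)"

lemma block_map_eq:
  assumes "subspace V" "e0 \<notin> V" "v \<in> V"
  shows "block_map V e0 D \<gamma> \<alpha> (v + scale t e0) = (D v + scale t \<gamma>) + scale (\<alpha> * t) e0"
proof -
  have "e0_coord V e0 (v + scale t e0) = t"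
    unfolding e0_coord_def
  proof (rule the_equality)
    show "v + scale t e0 - scale t e0 \<in> V" using assms by simp
  next
    fix s assume "v + scale t e0 - scale s e0 \<in> V"
    then have "v + scale t e0 - scale s e0 - v \<in> V"
      using assms subspace_diff by blast
    then have "scale (t - s) e0 \<in> V"
      by (simp add: scale_left_diff_distrib algebra_simps)
    then have "scale (inverse (t - s)) (scale (t - s) e0) \<in> V"
      using assms subspace_scale by blast
    then show "s = t" using assms by (cases "t - s = 0") auto
  qed
  then show ?thesis by (simp add: block_map_def)
qed

end

locale almost_abelian_lie_algebra = lie_algebra scale bracket
  for scale :: "'f::field \<Rightarrow> 'a::ab_group_add \<Rightarrow> 'a" and bracket +
  assumes not_abelian: "\<not> abelian_on UNIV"
    and codim_one_abelian_subalgebra: "\<exists>S. lie_subalgebra S \<and> abelian_on S \<and> codim_one S"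

definition lie_isomorphism ::
  "('f::field \<Rightarrow> 'a::ab_group_add \<Rightarrow> 'a) \<Rightarrow> ('a \<Rightarrow> 'a \<Rightarrow> 'a) \<Rightarrow>
   ('f \<Rightarrow> 'b::ab_group_add \<Rightarrow> 'b) \<Rightarrow> ('b \<Rightarrow> 'b \<Rightarrow> 'b) \<Rightarrow> ('a \<Rightarrow> 'b) \<Rightarrow> bool" where
  "lie_isomorphism s1 b1 s2 b2 \<phi> \<longleftrightarrow>
     Vector_Spaces.linear s1 s2 \<phi> \<and> bij \<phi> \<and> (\<forall>x y. \<phi> (b1 x y) = b2 (\<phi> x) (\<phi> y))"

definition lie_isomorphic ::
  "('f::field \<Rightarrow> 'a::ab_group_add \<Rightarrow> 'a) \<Rightarrow> ('a \<Rightarrow> 'a \<Rightarrow> 'a) \<Rightarrow>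
   ('f \<Rightarrow> 'b::ab_group_add \<Rightarrow> 'b) \<Rightarrow> ('b \<Rightarrow> 'b \<Rightarrow> 'b) \<Rightarrow> bool" where
  "lie_isomorphic s1 b1 s2 b2 \<longleftrightarrow> (\<exists>\<phi>. lie_isomorphism s1 b1 s2 b2 \<phi>)"

definition lie_automorphisms ::
  "('f::field \<Rightarrow> 'a::ab_group_add \<Rightarrow> 'a) \<Rightarrow> ('a \<Rightarrow> 'a \<Rightarrow> 'a) \<Rightarrow> ('a \<Rightarrow> 'a) set" where
  "lie_automorphisms s b = {\<phi>. lie_isomorphism s b s b \<phi>}"

text \<open>The Heisenberg algebra: \<open>(x\<^sub>0, x\<^sub>1, x\<^sub>2)\<close> stands for \<open>x\<^sub>0 e\<^sub>0 + x\<^sub>1 e\<^sub>1 + x\<^sub>2 e\<^sub>2\<close>.\<close>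
definition heisenberg_scale :: "'f::field \<Rightarrow> 'f \<times> 'f \<times> 'f \<Rightarrow> 'f \<times> 'f \<times> 'f" where
  "heisenberg_scale = (\<lambda>c (x0, x1, x2). (c * x0, c * x1, c * x2))"

definition heisenberg_bracket ::
  "'f::field \<times> 'f \<times> 'f \<Rightarrow> 'f \<times> 'f \<times> 'f \<Rightarrow> 'f \<times> 'f \<times> 'f" where
  "heisenberg_bracket = (\<lambda>(x0, x1, x2) (y0, y1, y2). (0, x0 * y2 - x2 * y0, 0))"

lemma heisenberg_brackets:
  "heisenberg_bracket (1, 0, 0) (0, 0, 1) = (0, 1, 0 :: 'f::field)"
  "heisenberg_bracket (1, 0, 0) (0, 1, 0) = (0 :: 'f \<times> 'f \<times> 'f)"
  "heisenberg_bracket (0, 1, 0) (0, 0, 1) = (0 :: 'f \<times> 'f \<times> 'f)"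
  by (simp_all add: heisenberg_bracket_def zero_prod_def)

lemma lie_algebra_heisenberg:
  "lie_algebra (heisenberg_scale :: 'f::field \<Rightarrow> _) heisenberg_bracket"
proof -
  have "vector_space (heisenberg_scale :: 'f \<Rightarrow> _)"
    by unfold_locales (auto simp: heisenberg_scale_def algebra_simps)
  then show ?thesis
    by (auto simp: lie_algebra_def lie_algebra_axioms_def Vector_Spaces.linear_def
        module_hom_def module_hom_axioms_def vector_space_def module_def
        heisenberg_scale_def heisenberg_bracket_def zero_prod_def algebra_simps)
qed

end

theory Submission
  imports Defs
begin

text \<open>The content of the theorem is that every automorphism \<open>\<phi>\<close> maps the ideal \<open>V\<close> onto itself
  (\<open>automorphism_preserves_hyperplane_ideal\<close>): an indecomposable non-abelian Lie algebra in which
  two different abelian ideals \<open>V\<close> and \<open>W\<close> are hyperplanes is the Heisenberg algebra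
  (\<open>heisenberg_if_two_abelian_hyperplane_ideals\<close>). Choose \<open>w \<in> W - V\<close> and \<open>u \<in> V - W\<close>. The
  intersection \<open>K\<close> of \<open>V\<close> and \<open>W\<close> commutes with \<open>V\<close> and with \<open>W\<close>, which together span the whole
  algebra, so \<open>K\<close> is central, and \<open>w\<close>, \<open>u\<close> span a complement of \<open>K\<close>. All brackets are therefore
  multiples of \<open>z = [w, u]\<close>, which lies in \<open>K\<close> because both hyperplanes are ideals, and which is
  nonzero because the algebra is not abelian. A complement \<open>C\<close> of the line of \<open>z\<close> in \<open>K\<close> is a central
  direct factor, complementary to the Heisenberg algebra spanned by \<open>w\<close>, \<open>u\<close>, \<open>z\<close>;
  indecomposability forces \<open>C = 0\<close>.

  Once \<open>V\<close> is invariant, \<open>\<phi>\<close> is block triangular, \<open>\<Delta>\<close> is its restriction to \<open>V\<close>, and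
  \<open>\<phi> e0 = \<gamma> + \<alpha> e0\<close>. Since \<open>V\<close> is abelian, compatibility with the brackets reduces to the single
  family \<open>[e0, v]\<close>, to which \<open>\<gamma>\<close> contributes nothing: this is the relation between \<open>\<Delta>\<close>, \<open>\<alpha>\<close> and
  \<open>ad e0\<close>. The same computation read backwards makes each such block matrix an automorphism.\<close>

section \<open>Brackets, lines and hyperplanes\<close>

lemma lie_isomorphism_inv:
  assumes "lie_isomorphism s1 b1 s2 b2 \<phi>"
  shows "lie_isomorphism s2 b2 s1 b1 (inv \<phi>)"
proof -
  have vs: "vector_space s1" "vector_space s2" and bij: "bij \<phi>"
    and add: "\<And>x y. \<phi> (x + y) = \<phi> x + \<phi> y" and scale: "\<And>c x. \<phi> (s1 c x) = s2 c (\<phi> x)"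
    and br: "\<And>x y. \<phi> (b1 x y) = b2 (\<phi> x) (\<phi> y)"
    using assms by (auto simp: lie_isomorphism_def Vector_Spaces.linear_iff)
  have left: "inv \<phi> (\<phi> x) = x" and right: "\<phi> (inv \<phi> y) = y" for x y
    using bij by (simp_all add: bij_is_inj bij_is_surj surj_f_inv_f)
  have "inv \<phi> (x + y) = inv \<phi> x + inv \<phi> y" for x y
    using add left right by metis
  moreover have "inv \<phi> (s2 c x) = s1 c (inv \<phi> x)" for c x
    using scale left right by metis
  moreover have "inv \<phi> (b2 x y) = b1 (inv \<phi> x) (inv \<phi> y)" for x y
    using br left right by metis
  ultimately show ?thesis
    using vs bij by (simp add: lie_isomorphism_def Vector_Spaces.linear_iff bij_imp_bij_inv)
qed

context lie_algebra
begin

lemma bracket_add_right: "bracket x (y + z) = bracket x y + bracket x z"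
  and bracket_scale_right: "bracket x (scale c y) = scale c (bracket x y)"
  using bracket_linear_right by (auto simp: Vector_Spaces.linear_iff)

lemma bracket_add_left: "bracket (x + y) z = bracket x z + bracket y z"
  and bracket_scale_left: "bracket (scale c x) z = scale c (bracket x z)"
  using bracket_linear_left by (auto simp: Vector_Spaces.linear_iff)

lemma bracket_anticommute: "bracket y x = - bracket x y"
proof -
  have "bracket (x + y) (x + y) = bracket x x + bracket x y + (bracket y x + bracket y y)"
    by (simp only: bracket_add_left bracket_add_right add_ac)
  then have "bracket x y + bracket y x = 0"
    by (simp add: bracket_alternating)
  then show ?thesis by (rule minus_unique[symmetric])
qed

text \<open>Central summands drop out and the rest is alternating bilinear in two generators, so only
  a two by two determinant remains. This one formula serves both for the Heisenberg algebra and for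
  an algebra spanned by two elements and its centre.\<close>
lemma bracket_modulo_central:
  assumes "\<And>x. bracket x d = 0" and "\<And>x. bracket x d' = 0"
  shows "bracket (scale a w + scale b u + d) (scale a' w + scale b' u + d')
    = scale (a * b' - b * a') (bracket w u)"
proof -
  have "bracket d x = 0" for x
    using assms(1)[of x] bracket_anticommute[of x d] by simp
  then show ?thesis
    using assms bracket_anticommute[of w u]
    by (simp add: bracket_add_left bracket_add_right bracket_scale_left bracket_scale_right
        bracket_alternating scale_left_diff_distrib mult.commute)
qed

lemma line_outside_subspace:
  assumes "subspace S" "w \<notin> S" "scale c w \<in> S"
  shows "c = 0"
  using assms subspace_scale[OF assms(1,3), of "inverse c"] by (cases "c = 0") auto

text \<open>A hyperplane is complemented by the line through any vector outside it. This allows the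
  transversal of each of two hyperplanes to be chosen inside the other.\<close>
lemma hyperplane_change_direction:
  assumes "subspace V" and cover: "\<And>x. \<exists>t. x - scale t e \<in> V" and "w \<notin> V"
  shows "\<exists>t. x - scale t w \<in> V"
proof -
  obtain s where s: "w - scale s e \<in> V" using cover by blast
  obtain t where t: "x - scale t e \<in> V" using cover by blast
  have "s \<noteq> 0" using s \<open>w \<notin> V\<close> by auto
  then have "x - scale (t / s) w = (x - scale t e) - scale (t / s) (w - scale s e)"
    by (simp add: scale_right_diff_distrib)
  then show ?thesis
    using s t \<open>subspace V\<close> by (metis subspace_diff subspace_scale)
qed

lemma complement_of_line:
  assumes "subspace S" "z \<in> S" "z \<noteq> 0"
  obtains C where "subspace C" "C \<subseteq> S" "z \<notin> C" "\<And>x. x \<in> S \<Longrightarrow> \<exists>c. x - scale c z \<in> C"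
proof -
  obtain B where B: "{z} \<subseteq> B" "B \<subseteq> S" "independent B" "S \<subseteq> span B"
    using maximal_independent_subset_extend[of "{z}" S] assms by auto
  have "\<exists>c. x - scale c z \<in> span (B - {z})" if "x \<in> S" for x
    using span_breakdown[of z B x] B(1,4) that by blast
  moreover have "z \<notin> span (B - {z})" using B(1,3) by (auto simp: dependent_def)
  moreover have "span (B - {z}) \<subseteq> S"
    using B(2) assms(1) by (intro span_minimal) auto
  ultimately show thesis using that subspace_span by blast
qed

section \<open>Two abelian hyperplane ideals\<close>

text \<open>A basis \<open>w\<close>, \<open>u\<close>, \<open>[w, u]\<close> whose third vector is central leaves no freedom in the bracket.\<close>
lemma lie_isomorphic_heisenbergI:
  assumes central: "\<And>x. bracket x (bracket w u) = 0"
    and spanning: "\<And>x. \<exists>a b c. x = scale a w + scale b u + scale c (bracket w u)"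
    and indep: "\<And>a b c. scale a w + scale b u + scale c (bracket w u) = 0 \<Longrightarrow>
                  a = 0 \<and> b = 0 \<and> c = 0"
  shows "lie_isomorphic scale bracket
           (heisenberg_scale :: 'f \<Rightarrow> 'f \<times> 'f \<times> 'f \<Rightarrow> 'f \<times> 'f \<times> 'f) heisenberg_bracket"
proof -
  define z where "z = bracket w u"
  \<comment> \<open>In the coordinates of the model, the centre is the middle component.\<close>
  define \<psi> where "\<psi> = (\<lambda>(a, c, b). scale a w + scale b u + scale c z)"
  have add: "\<psi> (p + q) = \<psi> p + \<psi> q" for p q
    by (cases p; cases q) (simp add: \<psi>_def scale_left_distrib algebra_simps)
  have scale: "\<psi> (heisenberg_scale k p) = scale k (\<psi> p)" for k p
    by (cases p) (simp add: \<psi>_def heisenberg_scale_def scale_right_distrib)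
  have "vector_space (heisenberg_scale :: 'f \<Rightarrow> _)"
    using lie_algebra_heisenberg by (rule lie_algebra.axioms(1))
  then have lin: "Vector_Spaces.linear heisenberg_scale scale \<psi>"
    using add scale vector_space_axioms by (simp add: Vector_Spaces.linear_iff)
  have "surj \<psi>"
  proof (rule surj_def[THEN iffD2, rule_format])
    fix x
    show "\<exists>p. x = \<psi> p"
      using spanning[of x] by (force simp: \<psi>_def z_def)
  qed
  moreover have "inj \<psi>"
  proof (rule injI)
    fix p q assume "\<psi> p = \<psi> q"
    then have "\<psi> (p - q) = 0"
      using add[of "p - q" q] by simp
    moreover obtain a c b where "p - q = (a, c, b)" by (cases "p - q")
    ultimately have "p - q = 0"
      using indep[of a b c] by (simp add: \<psi>_def z_def zero_prod_def)
    then show "p = q" by simp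
  qed
  moreover have "\<psi> (heisenberg_bracket p q) = bracket (\<psi> p) (\<psi> q)" for p q
  proof -
    have "bracket x (scale c z) = 0" for x c
      using central by (simp add: z_def bracket_scale_right)
    then show ?thesis
      by (cases p; cases q)
        (simp add: \<psi>_def heisenberg_bracket_def bracket_modulo_central z_def)
  qed
  ultimately have "lie_isomorphism heisenberg_scale heisenberg_bracket scale bracket \<psi>"
    using lin by (simp add: lie_isomorphism_def bij_def)
  then show ?thesis
    using lie_isomorphism_inv unfolding lie_isomorphic_def by blast
qed

text \<open>This is where the exceptional role of the Heisenberg algebra comes from: its abelian
  hyperplane ideals are not unique, and up to central factors no other non-abelian Lie algebra
  has that property. The dimension may be infinite, so the central factor is found as a complement
  inside the intersection of the two hyperplanes, and not by counting dimensions.\<close>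
lemma heisenberg_if_two_abelian_hyperplane_ideals:
  assumes nonabelian: "\<not> abelian_on UNIV" and indec: "indecomposable"
    and V: "lie_ideal V" "abelian_on V" "\<And>x. \<exists>t. x - scale t e \<in> V"
    and W: "lie_ideal W" "abelian_on W" "\<And>x. \<exists>t. x - scale t f \<in> W"
    and "\<not> W \<subseteq> V"
  shows "lie_isomorphic scale bracket
           (heisenberg_scale :: 'f \<Rightarrow> 'f \<times> 'f \<times> 'f \<Rightarrow> 'f \<times> 'f \<times> 'f) heisenberg_bracket"
proof -
  have subV: "subspace V" and subW: "subspace W"
    using V W by (auto simp: lie_ideal_def)
  obtain w where w: "w \<in> W" "w \<notin> V" using \<open>\<not> W \<subseteq> V\<close> by blast
  have cover_w: "\<exists>t. x - scale t w \<in> V" for x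
    using hyperplane_change_direction[OF subV V(3) w(2)] .
  \<comment> \<open>Otherwise \<open>W\<close> contains the hyperplane \<open>V\<close> and the vector \<open>w\<close> outside it, and the whole algebra
    is abelian.\<close>
  have "\<not> V \<subseteq> W"
  proof
    assume "V \<subseteq> W"
    have "x \<in> W" for x
    proof -
      obtain t where "x - scale t w \<in> W" using cover_w \<open>V \<subseteq> W\<close> by blast
      from subspace_add[OF subW this subspace_scale[OF subW w(1), of t]]
      show ?thesis by simp
    qed
    then show False using W(2) nonabelian by (auto simp: abelian_on_def)
  qed
  then obtain u where u: "u \<in> V" "u \<notin> W" by blast
  have cover_u: "\<exists>t. x - scale t u \<in> W" for x
    using hyperplane_change_direction[OF subW W(3) u(2)] .
  define K where "K = V \<inter> W"
  have subK: "subspace K" using subV subW subspace_inter by (simp add: K_def)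
  have split: "\<exists>a b. \<exists>d\<in>K. x = scale a w + scale b u + d" for x
  proof -
    obtain a where a: "x - scale a w \<in> V" using cover_w by blast
    obtain b where b: "x - scale a w - scale b u \<in> W" using cover_u by blast
    have "x - scale a w - scale b u \<in> V"
      using a u(1) subV subspace_diff subspace_scale by blast
    then show ?thesis
      using b by (intro exI[of _ a] exI[of _ b] bexI[of _ "x - scale a w - scale b u"])
        (auto simp: K_def algebra_simps)
  qed
  have central: "bracket x d = 0" if "d \<in> K" for x d
  proof -
    have "bracket w d = 0" "bracket u d = 0" "\<And>k. k \<in> K \<Longrightarrow> bracket k d = 0"
      using that w u V(2) W(2) by (auto simp: K_def abelian_on_def)
    then show ?thesis
      using split[of x] by (auto simp: bracket_add_left bracket_scale_left)
  qed
  define z where "z = bracket w u"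
  have zK: "z \<in> K"
  proof -
    have "z \<in> V" using V(1) u(1) by (simp add: z_def lie_ideal_def)
    moreover have "- bracket u w \<in> W"
      using W(1) w(1) subspace_neg[OF subW] by (simp add: lie_ideal_def)
    ultimately show ?thesis by (simp add: K_def z_def bracket_anticommute[of w u])
  qed
  have bracket_split: "bracket (scale a w + scale b u + d) (scale a' w + scale b' u + d')
      = scale (a * b' - b * a') z" if "d \<in> K" "d' \<in> K" for a b d a' b' d'
    unfolding z_def using that central by (intro bracket_modulo_central) auto
  have "z \<noteq> 0"
  proof
    assume "z = 0"
    have "bracket x y = 0" for x y
    proof -
      obtain a b d where "d \<in> K" "x = scale a w + scale b u + d" using split by blast
      moreover obtain a' b' d' where "d' \<in> K" "y = scale a' w + scale b' u + d'"
        using split by blast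
      ultimately show ?thesis using bracket_split \<open>z = 0\<close> by simp
    qed
    then show False using nonabelian by (simp add: abelian_on_def)
  qed
  have indep_mod: "a = 0 \<and> b = 0" if "scale a w + scale b u \<in> K" for a b
  proof -
    have "scale a w + scale b u - scale b u \<in> V"
      using that u(1) subV subspace_diff subspace_scale K_def by blast
    then have "a = 0" using line_outside_subspace[OF subV w(2)] by simp
    with that have "scale b u \<in> W" by (simp add: K_def)
    then show ?thesis using \<open>a = 0\<close> line_outside_subspace[OF subW u(2)] by simp
  qed
  \<comment> \<open>The candidate direct factor; once it vanishes, \<open>K\<close> is the line of \<open>z\<close>.\<close>
  obtain C where C: "subspace C" "C \<subseteq> K" "z \<notin> C"
      and C_cover: "\<And>d. d \<in> K \<Longrightarrow> \<exists>c. d - scale c z \<in> C"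
    using complement_of_line[OF subK zK \<open>z \<noteq> 0\<close>] by blast
  have scale_z: "scale c z \<in> K" for c using zK subK subspace_scale by blast
  define H where "H = {scale a w + scale b u + scale c z | a b c. True}"
  have memH: "scale a w + scale b u + scale c z \<in> H" for a b c by (auto simp: H_def)
  have subH: "subspace H"
  proof (rule subspaceI)
    show "0 \<in> H" using memH[of 0 0 0] by simp
  next
    fix x y assume "x \<in> H" "y \<in> H"
    then obtain a b c a' b' c' where
      "x = scale a w + scale b u + scale c z" "y = scale a' w + scale b' u + scale c' z"
      by (auto simp: H_def)
    then have "x + y = scale (a + a') w + scale (b + b') u + scale (c + c') z"
      by (simp add: scale_left_distrib algebra_simps)
    then show "x + y \<in> H" using memH by simp
  next
    fix k x assume "x \<in> H"
    then obtain a b c where "x = scale a w + scale b u + scale c z" by (auto simp: H_def)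
    then have "scale k x = scale (k * a) w + scale (k * b) u + scale (k * c) z"
      by (simp add: scale_right_distrib)
    then show "scale k x \<in> H" using memH by simp
  qed
  \<comment> \<open>Used twice: it makes \<open>H\<close> and \<open>C\<close> meet trivially, and after \<open>C = {0}\<close> is known it says
    that \<open>w\<close>, \<open>u\<close>, \<open>z\<close> are linearly independent.\<close>
  have meet: "a = 0 \<and> b = 0 \<and> c = 0" if "scale a w + scale b u + scale c z \<in> C" for a b c
  proof -
    have "scale a w + scale b u + scale c z - scale c z \<in> K"
      using that C(2) scale_z subK subspace_diff by blast
    then have ab: "a = 0 \<and> b = 0" using indep_mod by simp
    then have "scale c z \<in> C" using that by simp
    then show ?thesis using ab line_outside_subspace[OF C(1,3)] by simp
  qed
  have H_subalgebra: "lie_subalgebra H"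
  proof -
    have "bracket x y \<in> H" if xy: "x \<in> H" "y \<in> H" for x y
    proof -
      obtain a b c a' b' c' where
        "x = scale a w + scale b u + scale c z" "y = scale a' w + scale b' u + scale c' z"
        using xy by (auto simp: H_def)
      then have "bracket x y = scale (a * b' - b * a') z"
        using bracket_split scale_z by simp
      then show ?thesis using memH[of 0 0 "a * b' - b * a'"] by simp
    qed
    then show ?thesis using subH by (simp add: lie_subalgebra_def)
  qed
  have C_subalgebra: "lie_subalgebra C"
    using C central subspace_0[OF C(1)] by (auto simp: lie_subalgebra_def)
  have sum: "\<exists>h\<in>H. \<exists>k\<in>C. x = h + k" for x
  proof -
    obtain a b d where d: "d \<in> K" "x = scale a w + scale b u + d" using split by blast
    obtain c where "d - scale c z \<in> C" using C_cover d(1) by blast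
    moreover have "x = (scale a w + scale b u + scale c z) + (d - scale c z)"
      using d(2) by (simp add: algebra_simps)
    ultimately show ?thesis using memH by blast
  qed
  have "H \<inter> C = {0}"
  proof
    show "H \<inter> C \<subseteq> {0}"
    proof
      fix x assume x: "x \<in> H \<inter> C"
      then obtain a b c where "x = scale a w + scale b u + scale c z" by (auto simp: H_def)
      then show "x \<in> {0}" using meet[of a b c] x by simp
    qed
  qed (use subspace_0[OF subH] subspace_0[OF C(1)] in auto)
  then have "direct_decomposition H C"
    using subH C(1) sum unfolding direct_decomposition_def by blast
  moreover have "H \<noteq> {0}" using memH[of 0 0 1] \<open>z \<noteq> 0\<close> by auto
  moreover have "\<forall>h\<in>H. \<forall>k\<in>C. bracket h k = 0" using C(2) central by blast
  ultimately have "C = {0}"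
    using indec H_subalgebra C_subalgebra unfolding indecomposable_def by blast
  show ?thesis
  proof (rule lie_isomorphic_heisenbergI)
    show "bracket x (bracket w u) = 0" for x using central zK z_def by simp
    show "\<exists>a b c. x = scale a w + scale b u + scale c (bracket w u)" for x
      using sum[of x] \<open>C = {0}\<close> by (auto simp: H_def z_def)
    show "a = 0 \<and> b = 0 \<and> c = 0" if "scale a w + scale b u + scale c (bracket w u) = 0" for a b c
      using meet[of a b c] that \<open>C = {0}\<close> by (simp add: z_def)
  qed
qed

section \<open>Automorphisms in block form\<close>

lemma semidirect_presentation_decompose:
  assumes "semidirect_presentation V e0"
  shows "\<exists>v\<in>V. \<exists>t. x = v + scale t e0"
proof -
  have "x \<in> {a + b | a b. a \<in> V \<and> b \<in> span {e0}}"
    using assms by (simp add: semidirect_presentation_def direct_decomposition_def)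
  then show ?thesis by (auto simp: span_singleton)
qed

lemma bracket_semidirect:
  assumes "abelian_on V" "v \<in> V" "v' \<in> V"
  shows "bracket (v + scale t e0) (v' + scale t' e0)
    = scale t (bracket e0 v') - scale t' (bracket e0 v)"
proof -
  have "bracket v v' = 0" using assms by (simp add: abelian_on_def)
  then show ?thesis
    using bracket_anticommute[of v e0]
    by (simp add: bracket_add_left bracket_add_right bracket_scale_left bracket_scale_right
        bracket_alternating)
qed

text \<open>The image of \<open>V\<close> is again an abelian ideal, complemented by the line of \<open>\<phi> e0\<close>, so it cannot
  leave \<open>V\<close>. In infinite dimension an inclusion of \<open>\<phi> ` V\<close> in \<open>V\<close> does not by itself give
  equality by a dimension count; the inverse automorphism supplies the other inclusion.\<close>
lemma automorphism_preserves_hyperplane_ideal: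
  assumes nonabelian: "\<not> abelian_on UNIV" and indec: "indecomposable"
    and pres: "semidirect_presentation V e0"
    and not_heis: "\<not> lie_isomorphic scale bracket
           (heisenberg_scale :: 'f \<Rightarrow> 'f \<times> 'f \<times> 'f \<Rightarrow> 'f \<times> 'f \<times> 'f) heisenberg_bracket"
    and auto: "lie_isomorphism scale bracket scale bracket \<phi>"
  shows "\<phi> ` V = V"
proof -
  have sub: "\<psi> ` V \<subseteq> V" if "lie_isomorphism scale bracket scale bracket \<psi>" for \<psi>
  proof (rule ccontr)
    assume "\<not> \<psi> ` V \<subseteq> V"
    have V: "lie_ideal V" "abelian_on V" using pres by (auto simp: semidirect_presentation_def)
    have add: "\<psi> (x + y) = \<psi> x + \<psi> y" and scale: "\<psi> (scale c x) = scale c (\<psi> x)"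
      and surj: "surj \<psi>" and br: "\<psi> (bracket x y) = bracket (\<psi> x) (\<psi> y)" for x y c
      using that by (auto simp: lie_isomorphism_def Vector_Spaces.linear_iff bij_def)
    have zero: "\<psi> 0 = 0" using scale[of 0 0] by simp
    have "subspace (\<psi> ` V)"
    proof -
      have sV: "subspace V" using V(1) by (simp add: lie_ideal_def)
      show ?thesis
      proof (rule subspaceI)
        show "0 \<in> \<psi> ` V" using subspace_0[OF sV] zero by (metis imageI)
        show "x + y \<in> \<psi> ` V" if "x \<in> \<psi> ` V" "y \<in> \<psi> ` V" for x y
          using that subspace_add[OF sV] by (auto simp: add[symmetric])
        show "scale c x \<in> \<psi> ` V" if "x \<in> \<psi> ` V" for c x
          using that subspace_scale[OF sV] by (auto simp: scale[symmetric])
      qed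
    qed
    moreover have "bracket x y \<in> \<psi> ` V" if y: "y \<in> \<psi> ` V" for x y
    proof -
      obtain x' where "x = \<psi> x'" using surj by (metis surjD)
      moreover obtain v where "v \<in> V" "y = \<psi> v" using y by auto
      ultimately have "bracket x y = \<psi> (bracket x' v)" and "bracket x' v \<in> V"
        using br V(1) by (auto simp: lie_ideal_def)
      then show ?thesis by simp
    qed
    ultimately have ideal: "lie_ideal (\<psi> ` V)" by (simp add: lie_ideal_def)
    have abelian: "abelian_on (\<psi> ` V)"
      using V(2) zero by (auto simp: abelian_on_def br[symmetric])
    have cover': "\<exists>t. x - scale t (\<psi> e0) \<in> \<psi> ` V" for x
    proof -
      obtain x' where "x = \<psi> x'" using surj by (metis surjD)
      moreover obtain v t where "v \<in> V" "x' = v + scale t e0"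
        using semidirect_presentation_decompose[OF pres] by blast
      ultimately have "x - scale t (\<psi> e0) = \<psi> v" by (simp add: add scale)
      then show ?thesis using \<open>v \<in> V\<close> by (metis imageI)
    qed
    have cover: "\<exists>t. x - scale t e0 \<in> V" for x
      using semidirect_presentation_decompose[OF pres, of x] by (metis add_diff_cancel_right')
    have "lie_isomorphic scale bracket
           (heisenberg_scale :: 'f \<Rightarrow> 'f \<times> 'f \<times> 'f \<Rightarrow> 'f \<times> 'f \<times> 'f) heisenberg_bracket"
      by (rule heisenberg_if_two_abelian_hyperplane_ideals[OF nonabelian indec V cover
            ideal abelian cover' \<open>\<not> \<psi> ` V \<subseteq> V\<close>])
    then show False using not_heis by simp
  qed
  have "inv \<phi> ` V \<subseteq> V" using sub[OF lie_isomorphism_inv[OF auto]] .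
  then have "\<phi> ` (inv \<phi> ` V) \<subseteq> \<phi> ` V" by blast
  moreover have "surj \<phi>" using auto by (simp add: lie_isomorphism_def bij_def)
  ultimately have "V \<subseteq> \<phi> ` V" by (simp add: image_f_inv_f)
  then show ?thesis using sub[OF auto] by blast
qed

text \<open>Invertibility of \<open>\<phi>\<close> passes to both diagonal blocks because \<open>\<phi>\<close> maps \<open>V\<close> onto \<open>V\<close>: if
  \<open>\<alpha>\<close> vanished, then \<open>\<phi> e0\<close> would already be the image of a vector of \<open>V\<close>.\<close>
lemma automorphism_block_form:
  assumes pres: "semidirect_presentation V e0"
    and auto: "lie_isomorphism scale bracket scale bracket \<phi>"
    and invariant: "\<phi> ` V = V"
  obtains \<Delta> \<gamma> \<alpha> where "\<phi> = block_map V e0 \<Delta> \<gamma> \<alpha>" "\<alpha> \<noteq> 0" "\<gamma> \<in> V"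
    "\<Delta> \<in> linear_automorphisms_on V"
    "\<forall>v\<in>V. \<Delta> (bracket e0 v) - scale \<alpha> (bracket e0 (\<Delta> v)) = 0"
proof -
  have V: "lie_ideal V" "abelian_on V" "e0 \<notin> V"
    using pres by (auto simp: semidirect_presentation_def)
  then have subV: "subspace V" by (simp add: lie_ideal_def)
  have add: "\<phi> (x + y) = \<phi> x + \<phi> y" and scale: "\<phi> (scale c x) = scale c (\<phi> x)"
    and inj: "inj \<phi>" and br: "\<phi> (bracket x y) = bracket (\<phi> x) (\<phi> y)" for x y c
    using auto by (auto simp: lie_isomorphism_def Vector_Spaces.linear_iff bij_def)
  obtain \<gamma> \<alpha> where \<gamma>: "\<gamma> \<in> V" and \<phi>_e0: "\<phi> e0 = \<gamma> + scale \<alpha> e0"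
    using semidirect_presentation_decompose[OF pres] by blast
  define \<Delta> where "\<Delta> = restrict \<phi> V"
  have \<Delta>: "\<Delta> v = \<phi> v" if "v \<in> V" for v using that by (simp add: \<Delta>_def)
  have "\<phi> x = block_map V e0 \<Delta> \<gamma> \<alpha> x" for x
  proof -
    obtain v t where v: "v \<in> V" "x = v + scale t e0"
      using semidirect_presentation_decompose[OF pres] by blast
    then show ?thesis
      using \<Delta> block_map_eq[OF subV V(3) v(1)]
      by (simp add: add scale \<phi>_e0 scale_right_distrib mult.commute)
  qed
  moreover have "\<alpha> \<noteq> 0"
  proof
    assume "\<alpha> = 0"
    then have "\<phi> e0 \<in> \<phi> ` V" using \<phi>_e0 \<gamma> invariant by simp
    then show False using inj V(3) by (simp add: inj_image_mem_iff)
  qed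
  moreover have "\<Delta> \<in> linear_automorphisms_on V"
  proof -
    have "bij_betw \<phi> V V" using inj invariant by (auto simp: bij_betw_def inj_on_def)
    then have "bij_betw \<Delta> V V" using \<Delta> bij_betw_cong by blast
    then show ?thesis
      using subV \<Delta> add scale
      by (auto simp: linear_automorphisms_on_def \<Delta>_def subspace_add subspace_scale)
  qed
  moreover have "\<Delta> (bracket e0 v) - scale \<alpha> (bracket e0 (\<Delta> v)) = 0" if v: "v \<in> V" for v
  proof -
    have "bracket e0 v \<in> V" using V(1) v by (simp add: lie_ideal_def)
    moreover have "bracket \<gamma> (\<phi> v) = 0" using V(2) \<gamma> invariant v by (auto simp: abelian_on_def)
    ultimately show ?thesis
      using v by (simp add: \<Delta> br \<phi>_e0 bracket_add_left bracket_scale_left)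
  qed
  ultimately show thesis using that \<gamma> by blast
qed

text \<open>In the bracket of two images the terms with \<open>\<gamma>\<close> are \<open>\<alpha> t t' [e0, \<gamma>]\<close>, once with each sign, so
  every \<open>\<gamma> \<in> V\<close> is admissible and only the relation between \<open>\<Delta>\<close> and \<open>\<alpha>\<close> constrains the matrix.\<close>
lemma block_map_automorphism:
  assumes pres: "semidirect_presentation V e0"
    and "\<alpha> \<noteq> 0" "\<gamma> \<in> V" and \<Delta>: "\<Delta> \<in> linear_automorphisms_on V"
    and commute: "\<forall>v\<in>V. \<Delta> (bracket e0 v) - scale \<alpha> (bracket e0 (\<Delta> v)) = 0"
  shows "lie_isomorphism scale bracket scale bracket (block_map V e0 \<Delta> \<gamma> \<alpha>)"
proof -
  have V: "lie_ideal V" "abelian_on V" "e0 \<notin> V"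
    using pres by (auto simp: semidirect_presentation_def)
  then have subV: "subspace V" by (simp add: lie_ideal_def)
  define \<phi> where "\<phi> = block_map V e0 \<Delta> \<gamma> \<alpha>"
  have \<phi>: "\<phi> (v + scale t e0) = (\<Delta> v + scale t \<gamma>) + scale (\<alpha> * t) e0" if "v \<in> V" for v t
    unfolding \<phi>_def using block_map_eq[OF subV V(3) that] .
  have \<Delta>_add: "\<Delta> (v + v') = \<Delta> v + \<Delta> v'" and \<Delta>_scale: "\<Delta> (scale c v) = scale c (\<Delta> v)"
    if "v \<in> V" "v' \<in> V" for v v' c
    using \<Delta> that by (auto simp: linear_automorphisms_on_def)
  have \<Delta>_bij: "bij_betw \<Delta> V V" using \<Delta> by (simp add: linear_automorphisms_on_def)
  then have \<Delta>_V: "\<Delta> v \<in> V" if "v \<in> V" for v using that by (rule bij_betwE[THEN bspec])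
  have dec: "\<exists>v\<in>V. \<exists>t. x = v + scale t e0" for x
    using semidirect_presentation_decompose[OF pres] .
  have image_V: "\<Delta> v + scale t \<gamma> \<in> V" if "v \<in> V" for v t
    using that \<Delta>_V \<open>\<gamma> \<in> V\<close> subV subspace_add subspace_scale by blast
  have scale: "\<phi> (scale c x) = scale c (\<phi> x)" for c x
  proof -
    obtain v t where v: "v \<in> V" "x = v + scale t e0" using dec by blast
    have "scale c x = scale c v + scale (c * t) e0" using v(2) by (simp add: scale_right_distrib)
    then show ?thesis
      using v \<phi> subspace_scale[OF subV v(1)] \<Delta>_scale
      by (simp add: scale_right_distrib mult.left_commute)
  qed
  have add: "\<phi> (x + y) = \<phi> x + \<phi> y" for x y
  proof -
    obtain v t where v: "v \<in> V" "x = v + scale t e0" using dec by blast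
    obtain v' t' where v': "v' \<in> V" "y = v' + scale t' e0" using dec by blast
    have "x + y = (v + v') + scale (t + t') e0"
      using v(2) v'(2) by (simp add: scale_left_distrib algebra_simps)
    then have "\<phi> (x + y) = (\<Delta> v + \<Delta> v' + scale (t + t') \<gamma>) + scale (\<alpha> * (t + t')) e0"
      using \<phi> subspace_add[OF subV v(1) v'(1)] \<Delta>_add[OF v(1) v'(1)] by simp
    also have "\<dots> = \<phi> x + \<phi> y"
      using v v' \<phi> by (simp add: scale_left_distrib distrib_left add_ac)
    finally show ?thesis .
  qed
  have "\<phi> (bracket x y) = bracket (\<phi> x) (\<phi> y)" for x y
  proof -
    obtain v t where v: "v \<in> V" "x = v + scale t e0" using dec by blast
    obtain v' t' where v': "v' \<in> V" "y = v' + scale t' e0" using dec by blast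
    have \<phi>_ad: "\<phi> (bracket e0 a) = scale \<alpha> (bracket e0 (\<Delta> a))" if "a \<in> V" for a
    proof -
      have "bracket e0 a \<in> V" using V(1) that by (simp add: lie_ideal_def)
      then show ?thesis using \<phi>[of "bracket e0 a" 0] commute that by simp
    qed
    have diff: "\<phi> (a - b) = \<phi> a - \<phi> b" for a b
      using add[of "a - b" b] by (simp add: algebra_simps)
    have "\<phi> (bracket x y)
        = scale (\<alpha> * t) (bracket e0 (\<Delta> v')) - scale (\<alpha> * t') (bracket e0 (\<Delta> v))"
      using v v' bracket_semidirect[OF V(2) v(1) v'(1)]
      by (simp add: diff scale \<phi>_ad mult.commute)
    also have "\<dots> = scale (\<alpha> * t) (bracket e0 (\<Delta> v' + scale t' \<gamma>))
        - scale (\<alpha> * t') (bracket e0 (\<Delta> v + scale t \<gamma>))"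
      by (simp add: bracket_add_right bracket_scale_right scale_right_distrib algebra_simps)
    also have "\<dots> = bracket (\<phi> x) (\<phi> y)"
      using v v' \<phi> bracket_semidirect[OF V(2) image_V[OF v(1)] image_V[OF v'(1)]] by simp
    finally show ?thesis .
  qed
  moreover have "inj \<phi>"
  proof (rule injI)
    fix x y assume "\<phi> x = \<phi> y"
    then have zero: "\<phi> (x - y) = 0" using add[of "x - y" y] by simp
    obtain v t where v: "v \<in> V" "x - y = v + scale t e0" using dec by blast
    have eq: "(\<Delta> v + scale t \<gamma>) + scale (\<alpha> * t) e0 = 0" using zero v \<phi> by simp
    then have "scale (\<alpha> * t) e0 = - (\<Delta> v + scale t \<gamma>)" by (metis minus_unique minus_minus)
    then have "scale (\<alpha> * t) e0 \<in> V" using subspace_neg[OF subV image_V[OF v(1)]] by simp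
    then have "t = 0" using line_outside_subspace[OF subV V(3)] \<open>\<alpha> \<noteq> 0\<close> by fastforce
    then have "\<Delta> v = \<Delta> 0"
      using eq \<Delta>_scale[OF v(1) v(1), of 0] by simp
    then have "v = 0"
      using \<Delta>_bij v(1) subspace_0[OF subV] by (auto simp: bij_betw_def inj_on_def)
    then show "x = y" using v(2) \<open>t = 0\<close> by simp
  qed
  moreover have "surj \<phi>"
  proof (rule surj_def[THEN iffD2, rule_format])
    fix y
    obtain v' t' where v': "v' \<in> V" "y = v' + scale t' e0" using dec by blast
    define t where "t = t' / \<alpha>"
    have "v' - scale t \<gamma> \<in> V" using v'(1) \<open>\<gamma> \<in> V\<close> subV subspace_diff subspace_scale by blast
    then obtain v where v: "v \<in> V" "\<Delta> v = v' - scale t \<gamma>"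
      using \<Delta>_bij by (metis bij_betw_iff_bijections)
    have "\<phi> (v + scale t e0) = y"
      using \<phi>[OF v(1)] v(2) v'(2) \<open>\<alpha> \<noteq> 0\<close> by (simp add: t_def)
    then show "\<exists>x. y = \<phi> x" by metis
  qed
  ultimately show ?thesis
    using add scale vector_space_axioms
    unfolding \<phi>_def[symmetric] by (simp add: lie_isomorphism_def Vector_Spaces.linear_iff bij_def)
qed

end

theorem proposition9:
  fixes scale :: "'f::field \<Rightarrow> 'a::ab_group_add \<Rightarrow> 'a"
    and bracket :: "'a \<Rightarrow> 'a \<Rightarrow> 'a"
    and V :: "'a set" and e0 :: 'a
  assumes "almost_abelian_lie_algebra scale bracket"
    and "lie_algebra.semidirect_presentation scale bracket V e0"
    and "lie_algebra.indecomposable scale bracket"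
    and "\<not> lie_isomorphic scale bracket
           (heisenberg_scale :: 'f \<Rightarrow> 'f \<times> 'f \<times> 'f \<Rightarrow> 'f \<times> 'f \<times> 'f) heisenberg_bracket"
  shows "lie_automorphisms scale bracket =
    {lie_algebra.block_map scale V e0 \<Delta> \<gamma> \<alpha> | \<Delta> \<gamma> \<alpha>.
       \<alpha> \<noteq> 0 \<and> \<gamma> \<in> V \<and> \<Delta> \<in> lie_algebra.linear_automorphisms_on scale V \<and>
       (\<forall>v\<in>V. \<Delta> (bracket e0 v) - scale \<alpha> (bracket e0 (\<Delta> v)) = 0)}"
    (is "_ = ?blocks")
proof -
  interpret almost_abelian_lie_algebra scale bracket by fact
  show ?thesis
  proof
    show "lie_automorphisms scale bracket \<subseteq> ?blocks"
    proof
      fix \<phi> assume "\<phi> \<in> lie_automorphisms scale bracket"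
      then have auto: "lie_isomorphism scale bracket scale bracket \<phi>"
        by (simp add: lie_automorphisms_def)
      have "\<phi> ` V = V"
        using automorphism_preserves_hyperplane_ideal[OF not_abelian assms(3,2,4) auto] .
      then show "\<phi> \<in> ?blocks"
        by (rule automorphism_block_form[OF assms(2) auto]) blast
    qed
    show "?blocks \<subseteq> lie_automorphisms scale bracket"
      using block_map_automorphism[OF assms(2)] by (auto simp: lie_automorphisms_def)
  qed
qed

end
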